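(* For all integers $n,r\ge 2$, $$|B_x(n,r)|\ \le\ 1+2\sum_{i=1}^{r-1}\binom{n}{i}\binom{r+2^i-1}{r}\Big/ i!\;+\;2\binom{n}{r}\binom{r+2^r}{r+1}\Big/ r!\;+\;2\sum_{i=r+1}^{n}\binom{n}{i}\binom{i+2^r-1}{i}\Big/ r!,$$ where $\binom{a}{b}=0$ when $b>a$ and empty sums are $0$.
   Context: Let $I$ (left vertices) and $O$ (right vertices) be disjoint finite sets with $|I|=n$ and $|O|=r$. An $(n,r)$-bipartite graph is $G=(I\oplus O,E)$ with edge set $E\subseteq I\times O$. The connected domain $I_c(G)$ is the set of vertices of $I$ with nonzero degree in $G$. Two $(n,r)$-bipartite graphs $G_1=(I\oplus O,E_1)$ and $G_2=(I\oplus O,E_2)$ are left-set-labeled equivalent if there exist bijections $\alpha:I\to I$ and $\beta:O\to O$ such that for all $x\in I,y\in O$, $(x,y)\in E_1$ iff $(\alpha(x),\beta(y))\in E_2$, and moreover $I_c(G_1)=I_c(G_2)$. $B_x(n,r)$ denotes the set of equivalence classes of $(n,r)$-bipartite graphs under left-set-labeled equivalence. *)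

theory Defs
  imports Complex_Main
begin

text \<open>The vertex sets \<open>I\<close> (left) and \<open>J\<close> (right) are fixed, so a bipartite graph on them is given
  by its edge set. The right vertex set is called \<open>J\<close> because \<open>O\<close> is an infix operator.\<close>

definition bipartite_graphs :: "'v set \<Rightarrow> 'v set \<Rightarrow> ('v \<times> 'v) set set" where
  "bipartite_graphs I J = {E. E \<subseteq> I \<times> J}"

definition left_degree :: "('v \<times> 'v) set \<Rightarrow> 'v \<Rightarrow> nat" where
  "left_degree E x = card {y. (x, y) \<in> E}"

definition connected_domain :: "'v set \<Rightarrow> ('v \<times> 'v) set \<Rightarrow> 'v set" where
  "connected_domain I E = {x \<in> I. left_degree E x \<noteq> 0}"

definition left_set_labeled_equivalent ::
    "'v set \<Rightarrow> 'v set \<Rightarrow> ('v \<times> 'v) set \<Rightarrow> ('v \<times> 'v) set \<Rightarrow> bool" where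
  "left_set_labeled_equivalent I J E\<^sub>1 E\<^sub>2 \<longleftrightarrow>
     (\<exists>\<alpha> \<beta>. bij_betw \<alpha> I I \<and> bij_betw \<beta> J J \<and>
        (\<forall>x\<in>I. \<forall>y\<in>J. (x, y) \<in> E\<^sub>1 \<longleftrightarrow> (\<alpha> x, \<beta> y) \<in> E\<^sub>2)) \<and>
     connected_domain I E\<^sub>1 = connected_domain I E\<^sub>2"

definition left_set_labeled_rel ::
    "'v set \<Rightarrow> 'v set \<Rightarrow> (('v \<times> 'v) set \<times> ('v \<times> 'v) set) set" where
  "left_set_labeled_rel I J =
     {(E\<^sub>1, E\<^sub>2). E\<^sub>1 \<in> bipartite_graphs I J \<and> E\<^sub>2 \<in> bipartite_graphs I J \<and>
        left_set_labeled_equivalent I J E\<^sub>1 E\<^sub>2}"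

definition B\<^sub>x :: "'v set \<Rightarrow> 'v set \<Rightarrow> ('v \<times> 'v) set set set" where
  "B\<^sub>x I J = bipartite_graphs I J // left_set_labeled_rel I J"

lemma left_set_labeled_equivalent_sym:
  assumes "left_set_labeled_equivalent I J E\<^sub>1 E\<^sub>2"
  shows "left_set_labeled_equivalent I J E\<^sub>2 E\<^sub>1"
proof -
  obtain \<alpha> \<beta> where ab: "bij_betw \<alpha> I I" "bij_betw \<beta> J J"
    and e: "\<forall>x\<in>I. \<forall>y\<in>J. (x, y) \<in> E\<^sub>1 \<longleftrightarrow> (\<alpha> x, \<beta> y) \<in> E\<^sub>2"
    and c: "connected_domain I E\<^sub>1 = connected_domain I E\<^sub>2"
    using assms unfolding left_set_labeled_equivalent_def by blast
  have "(x, y) \<in> E\<^sub>2 \<longleftrightarrow> (inv_into I \<alpha> x, inv_into J \<beta> y) \<in> E\<^sub>1" if "x \<in> I" "y \<in> J" for x y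
    using e that ab bij_betw_inv_into[OF ab(1)] bij_betw_inv_into[OF ab(2)]
    by (simp add: bij_betw_apply bij_betw_inv_into_right)
  then show ?thesis
    unfolding left_set_labeled_equivalent_def
    using bij_betw_inv_into[OF ab(1)] bij_betw_inv_into[OF ab(2)] c by metis
qed

lemma left_set_labeled_equivalent_trans:
  assumes "left_set_labeled_equivalent I J E\<^sub>1 E\<^sub>2" "left_set_labeled_equivalent I J E\<^sub>2 E\<^sub>3"
  shows "left_set_labeled_equivalent I J E\<^sub>1 E\<^sub>3"
proof -
  obtain \<alpha> \<beta> where ab: "bij_betw \<alpha> I I" "bij_betw \<beta> J J"
    and e: "\<forall>x\<in>I. \<forall>y\<in>J. (x, y) \<in> E\<^sub>1 \<longleftrightarrow> (\<alpha> x, \<beta> y) \<in> E\<^sub>2"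
    and c: "connected_domain I E\<^sub>1 = connected_domain I E\<^sub>2"
    using assms(1) unfolding left_set_labeled_equivalent_def by blast
  obtain \<gamma> \<delta> where gd: "bij_betw \<gamma> I I" "bij_betw \<delta> J J"
    and e': "\<forall>x\<in>I. \<forall>y\<in>J. (x, y) \<in> E\<^sub>2 \<longleftrightarrow> (\<gamma> x, \<delta> y) \<in> E\<^sub>3"
    and c': "connected_domain I E\<^sub>2 = connected_domain I E\<^sub>3"
    using assms(2) unfolding left_set_labeled_equivalent_def by blast
  have "\<forall>x\<in>I. \<forall>y\<in>J. (x, y) \<in> E\<^sub>1 \<longleftrightarrow> ((\<gamma> \<circ> \<alpha>) x, (\<delta> \<circ> \<beta>) y) \<in> E\<^sub>3"
    using e e' ab by (simp add: bij_betw_apply)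
  then show ?thesis
    unfolding left_set_labeled_equivalent_def
    using bij_betw_trans[OF ab(1) gd(1)] bij_betw_trans[OF ab(2) gd(2)] c c' by metis
qed

lemma equiv_left_set_labeled_rel:
  "equiv (bipartite_graphs I J) (left_set_labeled_rel I J)"
proof (rule equivI)
  show "left_set_labeled_rel I J \<subseteq> bipartite_graphs I J \<times> bipartite_graphs I J"
    by (auto simp: left_set_labeled_rel_def)
  have "left_set_labeled_equivalent I J E E" for E :: "('a \<times> 'a) set"
    unfolding left_set_labeled_equivalent_def
    by (intro conjI exI[of _ id]) (auto simp: bij_betw_id)
  then show "refl_on (bipartite_graphs I J) (left_set_labeled_rel I J)"
    by (auto simp: refl_on_def left_set_labeled_rel_def)
  show "sym (left_set_labeled_rel I J)"
    by (auto simp: sym_def left_set_labeled_rel_def intro: left_set_labeled_equivalent_sym)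
  show "trans (left_set_labeled_rel I J)"
    by (auto simp: trans_def left_set_labeled_rel_def intro: left_set_labeled_equivalent_trans)
qed

end

theory Submission
  imports Defs "HOL-Combinatorics.Permutations"
begin

text \<open>A class with connected domain \<open>D\<close> is determined by the multiset of columns, a multiset of
  \<open>|J|\<close> subsets of \<open>D\<close> up to permutations of \<open>D\<close>, and also by the multiset of rows, a multiset of
  \<open>|D|\<close> subsets of \<open>J\<close> up to permutations of \<open>J\<close>. So it suffices that for \<open>a = |P| < b\<close> the
  multisets of \<open>b\<close> subsets of \<open>P\<close> have at most \<open>2 ((b + 2\<^sup>a - 1) choose b) / a!\<close> orbits. By Burnside's
  lemma this means that the non-identity permutations of \<open>P\<close> together fix no more multisets than the
  identity does.

  A permutation moving \<open>k\<close> points fixes at most \<open>f = 2\<^bsup>a - k + k div 2\<^esup>\<close> of the \<open>N = 2\<^sup>a\<close> subsets, and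
  the number of invariant multisets is largest when all other subsets lie in orbits of size 2.
  Divided by the number of all multisets of size \<open>b\<close>, the resulting bound \<open>\<rho>\<^sub>b\<close> satisfies
  \<open>(N + b - 1) \<rho>\<^sub>b = f \<rho>\<^bsub>b-1\<^esub> + (b - 1) \<rho>\<^bsub>b-2\<^esub>\<close>. This recursion propagates the
  inequality from \<open>b = a + 1, a + 2\<close> to all larger \<open>b\<close>, and gives \<open>\<rho>\<^sub>b \<le> (4/5)\<^bsup>k b\<^esup>\<close> for
  \<open>b \<le> a + 2\<close> when \<open>a \<ge> 13\<close>, so that the sum over \<open>k\<close> is dominated by a geometric series. The cases
  \<open>a \<le> 12\<close> are evaluated.\<close>

section \<open>Invariant multisets\<close>

text \<open>\<open>fixed_poly f N b\<close> is \<open>b!\<close> times the coefficient of \<open>x\<^sup>b\<close> in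
  \<open>(1 - x)\<^bsup>-f\<^esup> (1 - x\<^sup>2)\<^bsup>-(N - f)/2\<^esup>\<close>, i.e. \<open>b!\<close> times the number of invariant multisets of size \<open>b\<close>
  for an involution of an \<open>N\<close>-set with \<open>f\<close> fixed points.\<close>

fun fixed_poly :: "nat \<Rightarrow> nat \<Rightarrow> nat \<Rightarrow> nat" where
  "fixed_poly f N 0 = 1"
| "fixed_poly f N (Suc 0) = f"
| "fixed_poly f N (Suc (Suc b)) = f * fixed_poly f N (Suc b) + (b + 1) * (N + b) * fixed_poly f N b"

lemma fixed_poly_mono:
  assumes "f \<le> f'"
  shows "fixed_poly f N b \<le> fixed_poly f' N b"
  using assms by (induction f N b rule: fixed_poly.induct) (auto intro!: add_mono mult_mono)

text \<open>For \<open>f = N\<close> the generating function is (1 - x)^(-N): this is the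
  contribution of the identity permutation.\<close>

lemma fixed_poly_diag: "fixed_poly N N b = pochhammer N b"
proof (induction N N b rule: fixed_poly.induct)
  case (3 f N b)
  then show ?case by (simp add: pochhammer_rec' algebra_simps)
qed (auto)

text \<open>Removing m copies of a 2-element orbit lowers the size of a multiset by 2m, whence the
  arguments b - 2, b - 4, ...\<close>

definition alternate_sum :: "(nat \<Rightarrow> 'a::comm_monoid_add) \<Rightarrow> nat \<Rightarrow> 'a" where
  "alternate_sum F b = (\<Sum>m=1..b div 2. F (b - 2 * m))"

lemma alternate_sum_Suc_Suc:
  "alternate_sum F (Suc (Suc b)) = F b + alternate_sum F b"
  unfolding alternate_sum_def One_nat_def sum.atLeast1_atMost_eq
  by (simp add: sum.lessThan_Suc_shift del: sum.lessThan_Suc)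

text \<open>Coefficient form of x G' = (f x / (1 - x) + (N - f) x^2 / (1 - x^2)) G, the logarithmic
  derivative of the generating function. \<open>invariant_msets_recursion\<close> has the same shape
  with an inequality.\<close>

lemma fixed_poly_long_recursion:
  fixes f N b :: nat
  assumes "f \<le> N"
  defines "G \<equiv> \<lambda>j. real (fixed_poly f N j) / fact j"
  shows "real b * G b = real f * (\<Sum>j<b. G j) + real (N - f) * alternate_sum G b"
proof (induction b rule: induct_nat_012)
  case 0
  then show ?case by (simp add: alternate_sum_def)
next
  case 1
  then show ?case by (simp add: alternate_sum_def G_def)
next
  case (ge2 b)
  have "real (Suc (Suc b)) * G (Suc (Suc b))
      = real (fixed_poly f N (Suc (Suc b))) / fact (Suc b)"
    unfolding G_def fact_Suc[of "Suc b"] by (simp del: fixed_poly.simps of_nat_Suc fact_Suc)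
  also have "\<dots> = f * G (Suc b) + (N + b) * G b"
  proof -
    have "real (fixed_poly f N (Suc (Suc b)))
        = f * real (fixed_poly f N (Suc b)) + (real b + 1) * ((N + b) * real (fixed_poly f N b))"
      by (simp add: algebra_simps)
    moreover have "fact (Suc b) = (real b + 1) * fact b" by simp
    moreover have "real b + 1 \<noteq> 0" by linarith
    ultimately show ?thesis
      unfolding G_def
      by (simp only: add_divide_distrib mult_divide_mult_cancel_left times_divide_eq_right simp_thms)
  qed
  \<comment> \<open>Splitting N + b as f + (N - f) + b isolates b * G b for the induction
    hypothesis; the other terms extend the two sums from b to b + 2.\<close>
  also have "\<dots> = f * G (Suc b) + f * G b + (N - f) * G b + b * G b"
    using assms(1) by (simp add: algebra_simps of_nat_diff)
  finally show ?case
    using ge2(1) by (simp add: alternate_sum_Suc_Suc algebra_simps)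
qed

section \<open>Multisets invariant under a bijection\<close>

definition invariant_msets :: "('a \<Rightarrow> 'a) \<Rightarrow> 'a set \<Rightarrow> nat \<Rightarrow> 'a multiset set" where
  "invariant_msets \<pi> X b =
     {M. set_mset M \<subseteq> X \<and> size M = b \<and> (\<forall>x\<in>X. count M (\<pi> x) = count M x)}"

lemma finite_invariant_msets:
  assumes "finite X"
  shows "finite (invariant_msets \<pi> X b)"
  by (rule finite_subset[OF _ finite_multisets_of_size[OF assms, of b]])
    (auto simp: invariant_msets_def multisets_of_size_def)

text \<open>Membership in the stable set \<open>S\<close> is preserved by \<pi>, so subtracting m
  copies of \<open>S\<close> lowers the counts at x and \<pi> x equally.\<close>

lemma invariant_msets_diff:
  assumes "finite X" "bij_betw \<pi> X X" "S \<subseteq> X" "\<pi> ` S = S"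
    "M \<in> invariant_msets \<pi> X b" "\<And>y. y \<in> S \<Longrightarrow> m \<le> count M y"
  shows "repeat_mset m (mset_set S) \<subseteq># M"
    and "M - repeat_mset m (mset_set S) \<in> invariant_msets \<pi> X (b - m * card S)"
    and "m * card S \<le> b"
proof -
  have fS: "finite S" using assms finite_subset by blast
  show sub: "repeat_mset m (mset_set S) \<subseteq># M"
    using assms(6) fS by (auto simp: subseteq_mset_def count_mset_set')
  have "(\<pi> x \<in> S) = (x \<in> S)" if "x \<in> X" for x
    using assms(2-4) that by (metis bij_betw_imp_inj_on image_eqI inj_on_image_mem_iff)
  then show "M - repeat_mset m (mset_set S) \<in> invariant_msets \<pi> X (b - m * card S)"
    using assms(5) fS sub
    by (auto simp: invariant_msets_def count_mset_set' size_Diff_submset dest: in_diffD)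
  show "m * card S \<le> b"
    using size_mset_mono[OF sub] assms(5) by (simp add: invariant_msets_def)
qed

lemma card_invariant_msets_count_ge:
  assumes "finite X" "bij_betw \<pi> X X" "S \<subseteq> X" "\<pi> ` S = S"
    and "\<And>M. M \<in> A \<Longrightarrow> M \<in> invariant_msets \<pi> X b \<and> (\<forall>y\<in>S. m \<le> count M y)"
  shows "card A \<le> card (invariant_msets \<pi> X (b - m * card S))"
proof (rule card_inj_on_le)
  let ?R = "repeat_mset m (mset_set S)"
  show "inj_on (\<lambda>M. M - ?R) A"
    by (rule inj_onI) (metis assms invariant_msets_diff(1) subset_mset.diff_add)
  show "(\<lambda>M. M - ?R) ` A \<subseteq> invariant_msets \<pi> X (b - m * card S)"
    using invariant_msets_diff(2)[OF assms(1-4)] assms(5) by blast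
qed (simp add: assms finite_invariant_msets)

text \<open>Adding copies of the fixed point \<open>z\<close> is injective. This allows an orbit of
  more than two elements to be treated as one of size 2.\<close>

lemma card_invariant_msets_mono:
  assumes "finite X" "bij_betw \<pi> X X" "z \<in> X" "\<pi> z = z" "b \<le> c"
  shows "card (invariant_msets \<pi> X b) \<le> card (invariant_msets \<pi> X c)"
proof (rule card_inj_on_le)
  let ?R = "replicate_mset (c - b) z"
  show "inj_on (\<lambda>M. M + ?R) (invariant_msets \<pi> X b)"
    by (rule inj_onI) simp
  have "(\<pi> x = z) = (x = z)" if "x \<in> X" for x
    using assms that by (metis bij_betw_imp_inj_on inj_onD)
  then show "(\<lambda>M. M + ?R) ` invariant_msets \<pi> X b \<subseteq> invariant_msets \<pi> X c"
    using assms by (auto simp: invariant_msets_def split: if_splits)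
qed (simp add: assms finite_invariant_msets)

text \<open>\<open>S\<close> is the forward orbit of x; on a finite set an injective map sends it
  onto itself.\<close>

lemma nonfixed_orbit:
  assumes "finite X" "bij_betw \<pi> X X" "x \<in> X" "\<pi> x \<noteq> x"
  obtains S where "S \<subseteq> X" "\<pi> ` S = S" "x \<in> S" "card S \<ge> 2"
    "\<And>M b y. M \<in> invariant_msets \<pi> X b \<Longrightarrow> y \<in> S \<Longrightarrow> count M y = count M x"
proof
  define S where "S = range (\<lambda>i. (\<pi> ^^ i) x)"
  have X: "(\<pi> ^^ i) x \<in> X" for i
    using assms by (induction i) (auto simp: bij_betw_apply)
  then show SX: "S \<subseteq> X" by (auto simp: S_def)
  then have fS: "finite S" using assms finite_subset by blast
  have "\<pi> ` S \<subseteq> S"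
  proof
    fix y assume "y \<in> \<pi> ` S"
    then obtain i where "y = (\<pi> ^^ Suc i) x" by (auto simp: S_def)
    then show "y \<in> S" unfolding S_def by blast
  qed
  moreover have "inj_on \<pi> S"
    using SX assms(2) by (meson bij_betw_imp_inj_on inj_on_subset)
  ultimately show "\<pi> ` S = S" using fS by (simp add: endo_inj_surj)
  have "x = (\<pi> ^^ 0) x" "\<pi> x = (\<pi> ^^ 1) x" by auto
  then have xS: "x \<in> S" "\<pi> x \<in> S" unfolding S_def by blast+
  then show "x \<in> S" by simp
  have "card {x, \<pi> x} \<le> card S" using xS fS by (intro card_mono) auto
  then show "card S \<ge> 2" using assms(4) by simp
  fix M b y assume M: "M \<in> invariant_msets \<pi> X b" and "y \<in> S"
  have "count M ((\<pi> ^^ i) x) = count M x" for i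
    using M X by (induction i) (auto simp: invariant_msets_def)
  then show "count M y = count M x" using \<open>y \<in> S\<close> by (auto simp: S_def)
qed

text \<open>Double counting: the sum of all sizes counts triples (M, x, m) with 1 \<le> m \<le>
  \<open>count M x\<close>. For fixed x and m, subtracting m copies of the orbit of x injects these
  M into smaller invariant multisets.\<close>

lemma invariant_msets_recursion:
  fixes \<pi> :: "'a \<Rightarrow> 'a" and X :: "'a set"
  assumes "finite X" "bij_betw \<pi> X X" "z \<in> X" "\<pi> z = z"
  defines "F \<equiv> \<lambda>b. card (invariant_msets \<pi> X b)"
    and "f \<equiv> card {x \<in> X. \<pi> x = x}"
  shows "b * F b \<le> f * (\<Sum>j<b. F j) + (card X - f) * alternate_sum F b"
proof -
  let ?A = "\<lambda>x m. {M \<in> invariant_msets \<pi> X b. m \<le> count M x}"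
  have fin: "finite (invariant_msets \<pi> X b)" using assms finite_invariant_msets by blast
  have "b * F b = (\<Sum>M\<in>invariant_msets \<pi> X b. size M)"
    by (simp add: F_def invariant_msets_def)
  also have "\<dots> = (\<Sum>M\<in>invariant_msets \<pi> X b. \<Sum>x\<in>X. \<Sum>m=1..b. if m \<le> count M x then 1 else 0)"
  proof (rule sum.cong[OF refl])
    fix M assume M: "M \<in> invariant_msets \<pi> X b"
    have "(\<Sum>m=1..b. if m \<le> count M x then 1 else 0) = count M x" for x
    proof -
      have "count M x \<le> b" using M count_le_size[of M x] by (auto simp: invariant_msets_def)
      then have "{m \<in> {1..b}. m \<le> count M x} = {1..count M x}" by auto
      then show ?thesis by (simp flip: sum.inter_filter)
    qed
    moreover have "size M = (\<Sum>x\<in>X. count M x)"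
      unfolding size_multiset_overloaded_eq using M assms(1)
      by (intro sum.mono_neutral_left) (auto simp: invariant_msets_def not_in_iff)
    ultimately show "size M = (\<Sum>x\<in>X. \<Sum>m=1..b. if m \<le> count M x then 1 else 0)" by simp
  qed
  also have "\<dots> = (\<Sum>x\<in>X. \<Sum>M\<in>invariant_msets \<pi> X b. \<Sum>m=1..b. if m \<le> count M x then 1 else 0)"
    by (rule sum.swap)
  also have "\<dots> = (\<Sum>x\<in>X. \<Sum>m=1..b. \<Sum>M\<in>invariant_msets \<pi> X b. if m \<le> count M x then 1 else 0)"
    by (intro sum.cong refl sum.swap)
  also have "\<dots> = (\<Sum>x\<in>X. \<Sum>m=1..b. card (?A x m))"
    using fin by (simp flip: sum.inter_filter)
  also have "\<dots> \<le> (\<Sum>x\<in>X. if \<pi> x = x then \<Sum>j<b. F j else alternate_sum F b)"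
  proof (rule sum_mono)
    fix x assume x: "x \<in> X"
    show "(\<Sum>m=1..b. card (?A x m)) \<le> (if \<pi> x = x then \<Sum>j<b. F j else alternate_sum F b)"
    proof (cases "\<pi> x = x")
      case True
      have "card (?A x m) \<le> F (b - m)" for m
        using card_invariant_msets_count_ge[OF assms(1,2), of "{x}" "?A x m" b m] True x
        by (simp add: F_def)
      then have "(\<Sum>m=1..b. card (?A x m)) \<le> (\<Sum>m=1..b. F (b - m))"
        by (intro sum_mono) auto
      also have "\<dots> = (\<Sum>j<b. F j)"
        by (rule sum.reindex_bij_witness[of _ "\<lambda>j. b - j" "\<lambda>m. b - m"]) auto
      finally show ?thesis using True by simp
    next
      case False
      obtain S where S: "S \<subseteq> X" "\<pi> ` S = S" "x \<in> S" "card S \<ge> 2"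
        "\<And>M b y. M \<in> invariant_msets \<pi> X b \<Longrightarrow> y \<in> S \<Longrightarrow> count M y = count M x"
        using nonfixed_orbit[OF assms(1,2) x False] by blast
      \<comment> \<open>The count m is attained on the whole orbit, which has at least two elements,
        so 2m \<le> b; this cuts the sum off at \<open>b div 2\<close>.\<close>
      have empty: "?A x m = {}" if "b < 2 * m" for m
      proof -
        have "m * card S \<ge> 2 * m" using S(4) by simp
        moreover have "m * card S \<le> b" if "M \<in> ?A x m" for M
          using invariant_msets_diff(3)[OF assms(1,2) S(1,2), of M b m] S(5) that by auto
        ultimately show ?thesis using that by (metis all_not_in_conv le_trans not_le)
      qed
      have le: "card (?A x m) \<le> F (b - 2 * m)" for m
      proof -
        have "card (?A x m) \<le> F (b - m * card S)"
          unfolding F_def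
          using S(5) by (intro card_invariant_msets_count_ge[OF assms(1,2) S(1,2)]) auto
        also have "\<dots> \<le> F (b - 2 * m)"
          unfolding F_def using S(4)
          by (intro card_invariant_msets_mono[OF assms(1-4)]) (simp add: diff_le_mono2)
        finally show ?thesis .
      qed
      have "(\<Sum>m=1..b. card (?A x m)) = (\<Sum>m=1..b div 2. card (?A x m))"
      proof (rule sum.mono_neutral_right)
        show "\<forall>m\<in>{1..b} - {1..b div 2}. card (?A x m) = 0"
        proof
          fix m assume "m \<in> {1..b} - {1..b div 2}"
          then have "b < 2 * m" by auto
          from empty[OF this] show "card (?A x m) = 0" by (simp only: card.empty)
        qed
      qed auto
      also have "\<dots> \<le> alternate_sum F b"
        unfolding alternate_sum_def by (intro sum_mono le)
      finally show ?thesis using False by simp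
    qed
  qed
  also have "\<dots> = f * (\<Sum>j<b. F j) + card {x \<in> X. \<pi> x \<noteq> x} * alternate_sum F b"
    using assms(1) by (simp add: sum.If_cases f_def Int_def)
  also have "card {x \<in> X. \<pi> x \<noteq> x} = card X - f"
  proof -
    have "{x \<in> X. \<pi> x \<noteq> x} = X - {x \<in> X. \<pi> x = x}" by auto
    then show ?thesis using assms(1) by (simp add: f_def card_Diff_subset)
  qed
  finally show ?thesis .
qed

text \<open>The true counts satisfy with \<le> the recursion that the scaled
  \<open>fixed_poly\<close> satisfies with equality. Its coefficients are nonnegative, so strong
  induction compares them.\<close>

lemma card_invariant_msets_le:
  assumes "finite X" "bij_betw \<pi> X X" "z \<in> X" "\<pi> z = z"
  shows "fact b * card (invariant_msets \<pi> X b) \<le> fixed_poly (card {x \<in> X. \<pi> x = x}) (card X) b"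
proof -
  define f where "f = card {x \<in> X. \<pi> x = x}"
  define F where "F = (\<lambda>b. card (invariant_msets \<pi> X b))"
  define G where "G = (\<lambda>j. real (fixed_poly f (card X) j) / fact j)"
  have fN: "f \<le> card X" unfolding f_def by (rule card_mono) (use assms in auto)
  have "real (F b) \<le> G b"
  proof (induction b rule: less_induct)
    case (less b)
    show ?case
    proof (cases "b = 0")
      case True
      have "invariant_msets \<pi> X 0 = {{#}}" by (auto simp: invariant_msets_def)
      then show ?thesis using True by (simp add: F_def G_def)
    next
      case False
      have "real b * F b = real (b * F b)" by simp
      also have "\<dots> \<le> real (f * (\<Sum>j<b. F j) + (card X - f) * alternate_sum F b)"
        using invariant_msets_recursion[OF assms, of b] unfolding F_def f_def
        by (simp only: of_nat_le_iff)
      also have "\<dots> = f * (\<Sum>j<b. real (F j)) + real (card X - f) * alternate_sum (\<lambda>j. real (F j)) b"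
        by (simp add: alternate_sum_def)
      also have "\<dots> \<le> f * (\<Sum>j<b. G j) + real (card X - f) * alternate_sum G b"
        unfolding alternate_sum_def using False
        by (intro add_mono mult_left_mono sum_mono less) auto
      also have "\<dots> = real b * G b"
        unfolding G_def by (rule fixed_poly_long_recursion[OF fN, symmetric])
      finally show ?thesis using False by simp
    qed
  qed
  then have "real (fact b * F b) \<le> real (fixed_poly f (card X) b)"
    by (simp add: G_def field_simps)
  then show ?thesis unfolding F_def f_def by (simp only: of_nat_le_iff)
qed

section \<open>The numerical inequality\<close>

text \<open>Here \<kappa> bounds the fraction of fixed points and \<mu> is the ratio of a geometric
  ansatz. The hypothesis \<open>step\<close> is the characteristic inequality of the two-term
  recursion, with the varying factor b + 1 replaced by its maximum c.\<close>

lemma fixed_poly_ratio_bound: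
  fixes \<kappa> \<mu> :: real
  assumes "real f \<le> \<kappa> * real N" "\<kappa> \<le> \<mu>" "0 \<le> \<mu>"
    and step: "\<kappa> * \<mu> * real N + real c \<le> \<mu>\<^sup>2 * real N"
    and "b \<le> Suc c"
  shows "real (fixed_poly f N b) \<le> \<mu> ^ b * real (pochhammer N b)"
  using \<open>b \<le> Suc c\<close>
proof (induction b rule: induct_nat_012)
  case 0
  then show ?case by simp
next
  case 1
  have "\<kappa> * real N \<le> \<mu> * real N" using assms by (intro mult_right_mono) auto
  then show ?case using assms by simp
next
  case (ge2 b)
  let ?P = "\<lambda>b. real (pochhammer N b)"
  have P1: "?P (Suc b) = (real N + real b) * ?P b" for b
    by (simp add: pochhammer_rec')
  have "real (fixed_poly f N (Suc (Suc b)))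
      = real f * real (fixed_poly f N (Suc b)) + real (b + 1) * (real N + real b) * real (fixed_poly f N b)"
    by (simp only: fixed_poly.simps of_nat_add of_nat_mult)
  also have "\<dots> \<le> (\<kappa> * real N) * (\<mu> ^ Suc b * ?P (Suc b)) + real c * (real N + real b) * (\<mu> ^ b * ?P b)"
  proof (rule add_mono; rule mult_mono)
    show "real (b + 1) * (real N + real b) \<le> real c * (real N + real b)"
      using ge2.prems by (intro mult_right_mono) auto
  qed (use ge2 assms in \<open>auto intro: order_trans[OF _ assms(1)]\<close>)
  also have "\<dots> = \<mu> ^ b * ?P (Suc b) * (\<kappa> * \<mu> * real N + real c)"
    by (simp add: P1 algebra_simps)
  also have "\<dots> \<le> \<mu> ^ b * ?P (Suc b) * (\<mu>\<^sup>2 * real N)"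
    using step assms by (intro mult_left_mono) auto
  also have "\<dots> \<le> \<mu> ^ b * ?P (Suc b) * (\<mu>\<^sup>2 * (real N + real (Suc b)))"
    using assms by (intro mult_left_mono) auto
  also have "\<dots> = \<mu> ^ Suc (Suc b) * ?P (Suc (Suc b))"
    by (simp add: P1 algebra_simps power2_eq_square)
  finally show ?case .
qed

text \<open>The hypothesis \<open>step\<close> above for \<open>\<kappa> = (5/7) ^ k\<close>, \<open>\<mu> = (4/5) ^ k\<close>, \<open>N = 2 ^ a\<close>, \<open>c = a + 1\<close>,
  divided by \<open>N\<close>.\<close>

lemma geometric_ansatz_step:
  fixes a k :: nat
  assumes "13 \<le> a" "2 \<le> k" "k \<le> a"
  shows "(4/7) ^ k + real (a + 1) / 2 ^ a \<le> (16/25 :: real) ^ k"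
proof -
  \<comment> \<open>\<open>s\<close> decreases from k = 2 on, so k = a is the worst case. In
    \<open>growth\<close>, 28/25 is the ratio of 16/25 to 4/7, and 25/21 is the ratio of 1 - 4/7 to
    1 - 16/25.\<close>
  define s where "s = (\<lambda>k. (16/25 :: real) ^ k - (4/7) ^ k)"
  have growth: "(28/25 :: real) ^ k \<ge> 25/21" if "k \<ge> 2" for k
  proof -
    have "(28/25 :: real)\<^sup>2 \<le> (28/25) ^ k" using that by (intro power_increasing) auto
    then show ?thesis by (simp add: power2_eq_square)
  qed
  have "s (Suc k) \<le> s k" if "k \<ge> 2" for k
  proof -
    have "(3/7) * (4/7) ^ k = (9/25) * ((25/21) * (4/7 :: real) ^ k)" by simp
    also have "\<dots> \<le> (9/25) * ((28/25) ^ k * (4/7) ^ k)"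
      using growth[OF that] by (intro mult_left_mono mult_right_mono) auto
    also have "\<dots> = (9/25) * (16/25) ^ k" by (simp flip: power_mult_distrib)
    finally show ?thesis by (simp add: s_def)
  qed
  then have "s a \<le> s k"
    using assms by (intro dec_induct[of k a "\<lambda>m. s m \<le> s k"]) (auto intro: order_trans)
  moreover have "real (a + 1) / 2 ^ a \<le> s a"
  proof -
    \<comment> \<open>The claim multiplied by 2^a. Each step multiplies the right side by at least
      8/7 and the left side by at most 8/7.\<close>
    have "real (a + 1) \<le> (32/25) ^ a - (8/7) ^ a"
      using \<open>13 \<le> a\<close>
    proof (induction a rule: dec_induct)
      case base
      show ?case by (simp add: power_divide)
    next
      case (step m)
      have "(0::real) \<le> (32/25) ^ m" by simp
      then have "(8/7) * ((32/25) ^ m - (8/7) ^ m) \<le> (32/25) ^ Suc m - (8/7 :: real) ^ Suc m"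
        by (simp add: algebra_simps)
      moreover have "real (Suc m + 1) \<le> (8/7) * real (m + 1)" using step by simp
      moreover have "(8/7) * real (m + 1) \<le> (8/7) * ((32/25) ^ m - (8/7) ^ m)"
        using step.IH by (rule mult_left_mono) simp
      ultimately show ?case by (meson order_trans)
    qed
    also have "(32/25 :: real) ^ a = (16/25) ^ a * 2 ^ a" by (simp flip: power_mult_distrib)
    also have "(8/7 :: real) ^ a = (4/7) ^ a * 2 ^ a" by (simp flip: power_mult_distrib)
    finally show ?thesis by (simp add: s_def field_simps)
  qed
  ultimately show ?thesis by (simp add: s_def)
qed

text \<open>5/7 is a rational slightly above 1/sqrt 2: its square 25/49 exceeds 1/2, and squaring
  removes the rounding in \<open>k div 2\<close>.\<close>

lemma half_power_le:
  "(1/2 :: real) ^ (k - k div 2) \<le> (5/7) ^ k"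
proof (rule power2_le_imp_le)
  have "((1/2 :: real) ^ (k - k div 2))\<^sup>2 = (1/2) ^ (2 * (k - k div 2))"
    by (simp add: mult.commute flip: power_mult)
  also have "\<dots> \<le> (1/2) ^ k" by (intro power_decreasing) auto
  also have "\<dots> \<le> (25/49) ^ k" by (intro power_mono) auto
  also have "\<dots> = ((5/7) ^ k)\<^sup>2" by (simp add: power2_eq_square flip: power_mult_distrib)
  finally show "((1/2 :: real) ^ (k - k div 2))\<^sup>2 \<le> ((5/7) ^ k)\<^sup>2" .
qed auto

text \<open>The ratio bound with \<kappa> = 2^(-(k - k div 2)) \<le> (5/7)^k and \<mu> = (4/5)^k;
  the 4/7 and 16/25 above are 5/7 * 4/5 and (4/5)^2.\<close>

lemma fixed_poly_geometric_bound:
  assumes "13 \<le> a" "2 \<le> k" "k \<le> a" "b \<le> a + 2"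
  shows "real (fixed_poly (2 ^ (a - k + k div 2)) (2 ^ a) b) \<le> ((4/5) ^ k) ^ b * real (pochhammer (2 ^ a) b)"
proof (rule fixed_poly_ratio_bound)
  let ?\<kappa> = "(1/2 :: real) ^ (k - k div 2)"
  have "a = (a - k + k div 2) + (k - k div 2)" using assms by simp
  then have "(2::real) ^ a = 2 ^ (a - k + k div 2) * 2 ^ (k - k div 2)" by (metis power_add)
  then show "real (2 ^ (a - k + k div 2)) \<le> ?\<kappa> * real (2 ^ a)"
    by (simp add: power_one_over)
  have "(5/7 :: real) ^ k \<le> (4/5) ^ k" by (intro power_mono) auto
  with half_power_le[of k] show "?\<kappa> \<le> (4/5) ^ k" by linarith
  have "?\<kappa> * (4/5) ^ k \<le> (5/7) ^ k * (4/5) ^ k"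
    using half_power_le by (intro mult_right_mono) auto
  also have "\<dots> = (4/7) ^ k" by (simp flip: power_mult_distrib)
  finally have "?\<kappa> * (4/5) ^ k + real (a + 1) / 2 ^ a \<le> (16/25) ^ k"
    using geometric_ansatz_step[OF assms(1-3)] by linarith
  also have "(16/25 :: real) ^ k = ((4/5) ^ k)\<^sup>2"
    by (simp add: power2_eq_square flip: power_mult_distrib)
  finally have "(?\<kappa> * (4/5) ^ k + real (a + 1) / 2 ^ a) * 2 ^ a \<le> ((4/5) ^ k)\<^sup>2 * 2 ^ a"
    by (rule mult_right_mono) simp
  then show "?\<kappa> * (4/5) ^ k * real (2 ^ a) + real (a + 1) \<le> ((4/5) ^ k)\<^sup>2 * real (2 ^ a)"
    by (simp only: distrib_right) simp
qed (use assms in auto)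

section \<open>Derangement numbers and the sum over non-identity permutations\<close>

text \<open>\<open>derangements k\<close> is determined by \<open>k! = (\<Sum>j\<le>k. (k choose j) * derangements j)\<close>; the
  truncated subtraction never truncates.\<close>

fun derangements :: "nat \<Rightarrow> nat" where
  "derangements k = fact k - (\<Sum>j<k. (k choose j) * derangements j)"

declare derangements.simps [simp del]

lemma derangements_le_fact: "derangements k \<le> fact k"
  by (simp add: derangements.simps[of k])

lemma derangements_values:
  "derangements 0 = 1" "derangements (Suc 0) = 0" "derangements 2 = 1" "derangements 3 = 2"
  "derangements 4 = 9" "derangements 5 = 44"
proof -
  show d0: "derangements 0 = 1" by (simp add: derangements.simps[of 0])
  then show d1: "derangements (Suc 0) = 0" by (simp add: derangements.simps[of "Suc 0"])
  have "{..<2} = {0, Suc 0}" by auto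
  then show d2: "derangements 2 = 1"
    using d0 d1 by (simp add: derangements.simps[of 2])
  have "{..<3} = {0, Suc 0, 2}" by auto
  then show d3: "derangements 3 = 2"
    using d0 d1 d2 by (simp add: derangements.simps[of 3] binomial_fact' fact_numeral)
  have "{..<4} = {0, Suc 0, 2, 3}" by auto
  then show d4: "derangements 4 = 9"
    using d0 d1 d2 d3 by (simp add: derangements.simps[of 4] binomial_fact' fact_numeral)
  have "{..<5} = {0, Suc 0, 2, 3, 4}" by auto
  then show "derangements 5 = 44"
    using d0 d1 d2 d3 d4 by (simp add: derangements.simps[of 5] binomial_fact' fact_numeral)
qed

text \<open>Bounds \<open>fact b\<close> times the Burnside sum over the non-identity permutations
  of an a-set, grouped by the number k of moved points. The sum starts at 2 because no permutation
  moves exactly one point.\<close>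

definition nonid_sum :: "nat \<Rightarrow> nat \<Rightarrow> nat" where
  "nonid_sum a b =
     (\<Sum>k=2..a. (a choose k) * derangements k * fixed_poly (2 ^ (a - k + k div 2)) (2 ^ a) b)"

text \<open>Bounding every f by 2^a yields one recursion for the whole sum, which
  \<open>pochhammer (2 ^ a)\<close> satisfies with equality.\<close>

lemma nonid_sum_Suc_Suc:
  "nonid_sum a (Suc (Suc b)) \<le> 2 ^ a * nonid_sum a (Suc b) + (b + 1) * (2 ^ a + b) * nonid_sum a b"
proof -
  let ?c = "\<lambda>k. (a choose k) * derangements k" and ?f = "\<lambda>k. 2 ^ (a - k + k div 2) :: nat"
  have f: "?f k \<le> 2 ^ a" if "k \<in> {2..a}" for k
    using that by (intro power_increasing) auto
  have "nonid_sum a (Suc (Suc b))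
      \<le> (\<Sum>k=2..a. 2 ^ a * (?c k * fixed_poly (?f k) (2 ^ a) (Suc b))
            + (b + 1) * (2 ^ a + b) * (?c k * fixed_poly (?f k) (2 ^ a) b))"
    unfolding nonid_sum_def
  proof (rule sum_mono)
    fix k assume k: "k \<in> {2..a}"
    have "?f k * (?c k * fixed_poly (?f k) (2 ^ a) (Suc b))
        \<le> 2 ^ a * (?c k * fixed_poly (?f k) (2 ^ a) (Suc b))"
      using f[OF k] by (rule mult_right_mono) simp
    then show "?c k * fixed_poly (?f k) (2 ^ a) (Suc (Suc b))
      \<le> 2 ^ a * (?c k * fixed_poly (?f k) (2 ^ a) (Suc b))
            + (b + 1) * (2 ^ a + b) * (?c k * fixed_poly (?f k) (2 ^ a) b)"
      by (simp only: fixed_poly.simps distrib_left ac_simps)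
  qed
  also have "\<dots> = 2 ^ a * nonid_sum a (Suc b) + (b + 1) * (2 ^ a + b) * nonid_sum a b"
    unfolding nonid_sum_def by (simp add: sum.distrib sum_distrib_left)
  finally show ?thesis .
qed

lemma nonid_sum_le_large:
  assumes "13 \<le> a" "a + 1 \<le> b" "b \<le> a + 2"
  shows "nonid_sum a b \<le> pochhammer (2 ^ a) b"
proof -
  \<comment> \<open>Since (a choose k) * k! \<le> a^k, the k-th term is at most x^k times the
    Pochhammer symbol. With x \<le> 3/5 the series from k = 2 is at most (9/25) / (2/5) =
    9/10.\<close>
  define x :: real where "x = real a * (4/5) ^ (a + 1)"
  have "x \<le> 3/5"
    using \<open>13 \<le> a\<close> unfolding x_def
  proof (induction a rule: dec_induct)
    case base
    show ?case by (simp add: power_divide)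
  next
    case (step m)
    have "real (Suc m) * (4/5) \<le> real m" using step by simp
    then have "(real (Suc m) * (4/5)) * (4/5) ^ (m + 1) \<le> real m * (4/5) ^ (m + 1)"
      by (rule mult_right_mono) simp
    also have "\<dots> \<le> 3/5" by (rule step.IH)
    finally show ?case by (simp only: power_Suc add_Suc mult.assoc)
  qed
  moreover have x0: "0 \<le> x" by (simp add: x_def)
  let ?P = "real (pochhammer (2 ^ a) b)"
  have "real (nonid_sum a b)
      = (\<Sum>k=2..a. real ((a choose k) * derangements k) * real (fixed_poly (2 ^ (a - k + k div 2)) (2 ^ a) b))"
    by (simp add: nonid_sum_def)
  also have "\<dots> \<le> (\<Sum>k=2..a. real a ^ k * (((4/5) ^ k) ^ (a + 1) * ?P))"
  proof (rule sum_mono, rule mult_mono)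
    fix k assume k: "k \<in> {2..a}"
    have "(a choose k) * derangements k \<le> (a choose k) * fact k"
      using derangements_le_fact by (rule mult_left_mono) simp
    also have "\<dots> \<le> a ^ k" by (rule binomial_fact_pow)
    finally have "real ((a choose k) * derangements k) \<le> real (a ^ k)" by (simp only: of_nat_le_iff)
    then show "real ((a choose k) * derangements k) \<le> real a ^ k" by simp
    have "((4/5 :: real) ^ k) ^ b \<le> ((4/5) ^ k) ^ (a + 1)"
      using assms by (intro power_decreasing) (auto simp: power_le_one)
    then have "((4/5) ^ k) ^ b * ?P \<le> ((4/5) ^ k) ^ (a + 1) * ?P"
      by (rule mult_right_mono) simp
    then show "real (fixed_poly (2 ^ (a - k + k div 2)) (2 ^ a) b) \<le> ((4/5) ^ k) ^ (a + 1) * ?P"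
      using fixed_poly_geometric_bound[of a k b] assms k by simp
  qed auto
  also have "\<dots> = (\<Sum>k=2..a. x ^ k) * ?P"
    unfolding sum_distrib_right x_def power_mult_distrib
    by (intro sum.cong refl) (simp only: ac_simps flip: power_mult)
  also have "\<dots> \<le> 1 * ?P"
  proof (rule mult_right_mono)
    have "(\<Sum>k=2..a. x ^ k) = (x\<^sup>2 - x ^ Suc a) / (1 - x)"
      using assms \<open>x \<le> 3/5\<close> by (subst sum_gp) auto
    also have "\<dots> \<le> x\<^sup>2 / (1 - x)"
      using x0 \<open>x \<le> 3/5\<close> by (intro divide_right_mono) auto
    also have "\<dots> \<le> 1"
    proof -
      have "x\<^sup>2 \<le> (3/5)\<^sup>2" using x0 \<open>x \<le> 3/5\<close> by (intro power_mono)
      then show ?thesis using \<open>x \<le> 3/5\<close> by (simp add: power2_eq_square)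
    qed
    finally show "(\<Sum>k=2..a. x ^ k) \<le> 1" .
  qed simp
  finally show ?thesis by simp
qed

text \<open>Carrying two consecutive values through a fold makes evaluation linear in b, whereas
  unfolding the recursion branches twice.\<close>

lemma foldl_fixed_poly:
  assumes "2 \<le> b"
  shows "foldl (\<lambda>(x, y) j. (y, f * y + j * (N + j - 1) * x)) (f, f * f + N) [2..<b]
       = (fixed_poly f N (b - 1), fixed_poly f N b)"
  using assms
proof (induction b rule: dec_induct)
  case base
  show ?case by (simp add: numeral_2_eq_2)
next
  case (step b)
  then obtain c where "b = Suc c" by (cases b) auto
  then show ?case using step by simp
qed

lemma fixed_poly_eval:
  assumes "2 \<le> b"
  shows "fixed_poly f N b
     = snd (foldl (\<lambda>(x, y) j. (y, f * y + j * (N + j - 1) * x)) (f, f * f + N) [2..<b])"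
  by (simp only: foldl_fixed_poly[OF assms] snd_conv)

lemma pochhammer_eval:
  assumes "2 \<le> b"
  shows "pochhammer (N::nat) b = foldl (\<lambda>p j. p * (N + j)) (N * (N + 1)) [2..<b]"
  using assms
proof (induction b rule: dec_induct)
  case base
  show ?case by (simp add: numeral_2_eq_2 pochhammer_rec')
next
  case (step b)
  then show ?case by (simp add: pochhammer_rec')
qed

lemma sum_upt_eval: "(\<Sum>k=2..a. g k) = sum_list (map g [2..<Suc a])"
  by (simp only: interv_sum_list_conv_sum_set_nat set_upt atLeastLessThanSuc_atLeastAtMost)

lemma nonid_sum_le_small:
  assumes "a \<le> 12" "b = a + 1 \<or> b = a + 2"
  shows "nonid_sum a b \<le> pochhammer (2 ^ a) b"
proof -
  \<comment> \<open>For k from 2 to 5 these are the exact derangement numbers; beyond that the bound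
    k! is good enough for the evaluation.\<close>
  let ?d = "\<lambda>k. if k \<le> 2 then 1 else if k = 3 then 2 else if k = 4 then 9 else if k = 5 then 44 else fact k :: nat"
  have d: "derangements k \<le> ?d k" for k
  proof -
    have "k = 0 \<or> k = 1 \<or> k = 2 \<or> k = 3 \<or> k = 4 \<or> k = 5 \<or> k > 5" by linarith
    then show ?thesis using derangements_values derangements_le_fact[of k] by auto
  qed
  have "nonid_sum a b \<le> (\<Sum>k=2..a. (a choose k) * ?d k * fixed_poly (2 ^ (a - k + k div 2)) (2 ^ a) b)"
    unfolding nonid_sum_def by (intro sum_mono mult_right_mono mult_left_mono d) auto
  also have "\<dots> \<le> pochhammer (2 ^ a) b"
  proof -
    have "a < 2 \<or> a = 2 \<or> a = 3 \<or> a = 4 \<or> a = 5 \<or> a = 6 \<or> a = 7 \<or> a = 8 \<or> a = 9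
        \<or> a = 10 \<or> a = 11 \<or> a = 12"
      using assms(1) by presburger
    then show ?thesis
      using assms(2)
      by (elim disjE; simp add: sum_upt_eval;
          simp add: fixed_poly_eval pochhammer_eval binomial_fact' fact_numeral)
  qed
  finally show ?thesis .
qed

text \<open>The recursion reaches back two steps, so two consecutive initial values, at a + 1 and a
  + 2, carry the inequality to all larger b.\<close>

lemma nonid_sum_le:
  assumes "a + 1 \<le> b"
  shows "nonid_sum a b \<le> pochhammer (2 ^ a) b"
proof -
  have init: "nonid_sum a c \<le> pochhammer (2 ^ a) c" if "c = a + 1 \<or> c = a + 2" for c
    using nonid_sum_le_small[of a c] nonid_sum_le_large[of a c] that by (cases "a \<le> 12") auto
  have "nonid_sum a b \<le> pochhammer (2 ^ a) b \<and> nonid_sum a (Suc b) \<le> pochhammer (2 ^ a) (Suc b)"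
    using assms
  proof (induction b rule: dec_induct)
    case base
    show ?case using init[of "a + 1"] init[of "a + 2"] by simp
  next
    case (step b)
    have "nonid_sum a (Suc (Suc b))
        \<le> 2 ^ a * nonid_sum a (Suc b) + (b + 1) * (2 ^ a + b) * nonid_sum a b"
      by (rule nonid_sum_Suc_Suc)
    also have "\<dots> \<le> 2 ^ a * pochhammer (2 ^ a) (Suc b) + (b + 1) * (2 ^ a + b) * pochhammer (2 ^ a) b"
      using step.IH by (intro add_mono mult_left_mono) auto
    also have "\<dots> = pochhammer (2 ^ a) (Suc (Suc b))"
      by (simp add: pochhammer_rec' algebra_simps)
    finally show ?case using step.IH by simp
  qed
  then show ?thesis ..
qed

section \<open>Permutations by support\<close>

lemma sum_Pow_card:
  fixes h :: "nat \<Rightarrow> 'a::comm_semiring_1"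
  assumes "finite K"
  shows "(\<Sum>L\<in>Pow K. h (card L)) = (\<Sum>j\<le>card K. of_nat (card K choose j) * h j)"
proof -
  have "(\<Sum>L\<in>Pow K. h (card L)) = (\<Sum>j\<le>card K. \<Sum>L | L \<in> Pow K \<and> card L = j. h (card L))"
    using assms by (intro sum.group[symmetric]) (auto intro: card_mono)
  also have "\<dots> = (\<Sum>j\<le>card K. of_nat (card K choose j) * h j)"
    using n_subsets[OF assms] by (intro sum.cong refl) simp
  finally show ?thesis .
qed

definition full_permutations :: "'a set \<Rightarrow> ('a \<Rightarrow> 'a) set" where
  "full_permutations K = {\<sigma>. \<sigma> permutes K \<and> (\<forall>x\<in>K. \<sigma> x \<noteq> x)}"

text \<open>Permutations of \<open>P\<close> are grouped by support: those with support exactly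
  \<open>L\<close> are the fixed-point-free permutations of \<open>L\<close>.\<close>

lemma sum_permutes_support:
  fixes g :: "'a set \<Rightarrow> nat"
  assumes "finite P"
  shows "(\<Sum>\<sigma> | \<sigma> permutes P. g {x. \<sigma> x \<noteq> x}) = (\<Sum>L\<in>Pow P. card (full_permutations L) * g L)"
proof -
  have eq: "{\<sigma>. \<sigma> \<in> {\<sigma>. \<sigma> permutes P} \<and> {x. \<sigma> x \<noteq> x} = L} = full_permutations L" if "L \<subseteq> P" for L
  proof (intro set_eqI iffI)
    fix \<sigma> assume "\<sigma> \<in> {\<sigma>. \<sigma> \<in> {\<sigma>. \<sigma> permutes P} \<and> {x. \<sigma> x \<noteq> x} = L}"
    then have "\<sigma> permutes P" "{x. \<sigma> x \<noteq> x} = L" by auto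
    then show "\<sigma> \<in> full_permutations L"
      using permutes_superset[of \<sigma> P L] by (auto simp: full_permutations_def)
  next
    fix \<sigma> assume "\<sigma> \<in> full_permutations L"
    then have s: "\<sigma> permutes L" "\<forall>x\<in>L. \<sigma> x \<noteq> x" by (auto simp: full_permutations_def)
    then have "{x. \<sigma> x \<noteq> x} = L" by (auto dest: permutes_not_in)
    then show "\<sigma> \<in> {\<sigma>. \<sigma> \<in> {\<sigma>. \<sigma> permutes P} \<and> {x. \<sigma> x \<noteq> x} = L}"
      using permutes_subset[OF s(1) that] by auto
  qed
  have "(\<Sum>\<sigma> | \<sigma> permutes P. g {x. \<sigma> x \<noteq> x})
      = (\<Sum>L\<in>Pow P. \<Sum>\<sigma> | \<sigma> \<in> {\<sigma>. \<sigma> permutes P} \<and> {x. \<sigma> x \<noteq> x} = L. g {x. \<sigma> x \<noteq> x})"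
    using assms finite_permutations[OF assms]
    by (intro sum.group[symmetric]) (auto dest: permutes_not_in)
  also have "\<dots> = (\<Sum>L\<in>Pow P. \<Sum>\<sigma> | \<sigma> \<in> {\<sigma>. \<sigma> permutes P} \<and> {x. \<sigma> x \<noteq> x} = L. g L)"
    by (intro sum.cong refl) auto
  also have "\<dots> = (\<Sum>L\<in>Pow P. card (full_permutations L) * g L)"
    using eq by (intro sum.cong refl) (simp only: sum_constant Pow_iff of_nat_id)
  finally show ?thesis .
qed

text \<open>Grouping all k! permutations by support gives the recursion that defines
  \<open>derangements\<close>.\<close>

lemma card_full_permutations:
  assumes "finite K"
  shows "card (full_permutations K) = derangements (card K)"
  using assms
proof (induction "card K" arbitrary: K rule: less_induct)
  case less
  let ?k = "card K"
  have IH: "card (full_permutations L) = derangements (card L)" if "L \<in> Pow K - {K}" for L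
    using that less.prems by (intro less.hyps) (auto intro: psubset_card_mono finite_subset)
  have "fact ?k = (\<Sum>\<sigma> | \<sigma> permutes K. (1::nat))"
    using card_permutations[OF refl less.prems] by simp
  also have "\<dots> = (\<Sum>L\<in>Pow K. card (full_permutations L))"
    using sum_permutes_support[OF less.prems, of "\<lambda>_. 1"] by simp
  also have "\<dots> = card (full_permutations K) + (\<Sum>L\<in>Pow K - {K}. derangements (card L))"
    using less.prems IH by (subst sum.remove[of _ K]) auto
  finally have *: "fact ?k = card (full_permutations K) + (\<Sum>L\<in>Pow K - {K}. derangements (card L))" .
  have "(\<Sum>L\<in>Pow K. derangements (card L)) = derangements ?k + (\<Sum>L\<in>Pow K - {K}. derangements (card L))"
    using less.prems by (subst sum.remove[of _ K]) auto
  then have "(\<Sum>L\<in>Pow K - {K}. derangements (card L)) = (\<Sum>j<?k. (?k choose j) * derangements j)"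
    using sum_Pow_card[OF less.prems, of derangements] by (simp add: lessThan_Suc_atMost[symmetric])
  with * show ?case by (simp add: derangements.simps[of ?k])
qed

lemma sum_permutes_card_support:
  fixes g :: "nat \<Rightarrow> nat"
  assumes "finite P"
  shows "(\<Sum>\<sigma> | \<sigma> permutes P. g (card {x. \<sigma> x \<noteq> x}))
       = (\<Sum>k\<le>card P. (card P choose k) * derangements k * g k)"
proof -
  have "(\<Sum>\<sigma> | \<sigma> permutes P. g (card {x. \<sigma> x \<noteq> x})) = (\<Sum>L\<in>Pow P. derangements (card L) * g (card L))"
    using sum_permutes_support[OF assms, of "\<lambda>L. g (card L)"] assms
    by (simp add: card_full_permutations finite_subset)
  also have "\<dots> = (\<Sum>k\<le>card P. (card P choose k) * derangements k * g k)"
    using sum_Pow_card[OF assms, of "\<lambda>k. derangements k * g k"] by (simp add: mult.assoc)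
  finally show ?thesis .
qed

text \<open>An invariant set is a union of orbits, and there are at most \<open>card K div 2\<close>
  orbits. The induction removes the orbit \<open>S\<close> of one point, which lies inside or
  outside the invariant set as a whole.\<close>

lemma card_invariant_subsets_fixpoint_free:
  assumes "finite K" "bij_betw \<sigma> K K" "\<And>x. x \<in> K \<Longrightarrow> \<sigma> x \<noteq> x"
  shows "card {A. A \<subseteq> K \<and> \<sigma> ` A = A} \<le> 2 ^ (card K div 2)"
  using assms
proof (induction "card K" arbitrary: K rule: less_induct)
  case less
  show ?case
  proof (cases "K = {}")
    case True
    then have "{A. A \<subseteq> K \<and> \<sigma> ` A = A} = {{}}" by auto
    then show ?thesis by simp
  next
    case False
    then obtain x where x: "x \<in> K" by blast
    obtain S where S: "S \<subseteq> K" "\<sigma> ` S = S" "x \<in> S" "card S \<ge> 2"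
      "\<And>M b y. M \<in> invariant_msets \<sigma> K b \<Longrightarrow> y \<in> S \<Longrightarrow> count M y = count M x"
      using nonfixed_orbit[OF less.prems(1,2) x less.prems(3)[OF x]] by blast
    let ?Inv = "\<lambda>K. {A. A \<subseteq> K \<and> \<sigma> ` A = A}"
    have inj: "inj_on \<sigma> K" using less.prems(2) by (rule bij_betw_imp_inj_on)
    have mem: "y \<in> A \<longleftrightarrow> x \<in> A" if A: "A \<in> ?Inv K" and y: "y \<in> S" for A y
    proof -
      have fA: "finite A" using A less.prems(1) finite_subset by blast
      have "\<sigma> z \<in> A \<longleftrightarrow> z \<in> A" if "z \<in> K" for z
        using A inj_on_image_mem_iff[OF inj that, of A] by simp
      \<comment> \<open>Read as a multiset, an invariant subset has constant count on
        \<open>S\<close>, so it contains all of \<open>S\<close> or none of it.\<close>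
      then have "mset_set A \<in> invariant_msets \<sigma> K (card A)"
        using A fA by (auto simp: invariant_msets_def count_mset_set')
      then have "count (mset_set A) y = count (mset_set A) x" using S(5) y by blast
      then show ?thesis using fA by (auto simp: count_mset_set' split: if_splits)
    qed
    have diff: "\<sigma> ` (A - S) = A - S" if "A \<subseteq> K" "\<sigma> ` A = A" for A
      using inj_on_image_set_diff[OF inj, of A S] that S(1,2) by auto
    have fin: "finite (?Inv L)" if "L \<subseteq> K" for L
      using less.prems(1) that by (auto intro: finite_subset[of _ "Pow K"])
    have half: "card {A \<in> ?Inv K. x \<in> A \<longleftrightarrow> v} \<le> card (?Inv (K - S))" for v
    proof (rule card_inj_on_le[of "\<lambda>A. A - S"])
      show "inj_on (\<lambda>A. A - S) {A \<in> ?Inv K. x \<in> A \<longleftrightarrow> v}"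
      proof (rule inj_onI)
        fix A B assume A: "A \<in> {A \<in> ?Inv K. x \<in> A \<longleftrightarrow> v}" and B: "B \<in> {A \<in> ?Inv K. x \<in> A \<longleftrightarrow> v}"
          and eq: "A - S = B - S"
        have "y \<in> A \<longleftrightarrow> y \<in> B" for y
          using mem[of A y] mem[of B y] A B eq by (cases "y \<in> S") auto
        then show "A = B" by blast
      qed
      show "(\<lambda>A. A - S) ` {A \<in> ?Inv K. x \<in> A \<longleftrightarrow> v} \<subseteq> ?Inv (K - S)"
        using diff by auto
    qed (rule fin, auto)
    have fS: "finite S" using S(1) less.prems(1) finite_subset by blast
    have cS: "card (K - S) = card K - card S" "card S \<le> card K"
      using S(1) fS less.prems(1) by (auto simp: card_Diff_subset card_mono)
    have IH: "card (?Inv (K - S)) \<le> 2 ^ (card (K - S) div 2)"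
    proof (rule less.hyps)
      show "card (K - S) < card K" using cS S(4) by linarith
      show "bij_betw \<sigma> (K - S) (K - S)"
        using inj diff[of K] less.prems(2)
        by (auto simp: bij_betw_def intro: inj_on_subset)
    qed (use less.prems in auto)
    have "?Inv K = {A \<in> ?Inv K. x \<in> A \<longleftrightarrow> True} \<union> {A \<in> ?Inv K. x \<in> A \<longleftrightarrow> False}" by auto
    then have "card (?Inv K) \<le> card {A \<in> ?Inv K. x \<in> A \<longleftrightarrow> True} + card {A \<in> ?Inv K. x \<in> A \<longleftrightarrow> False}"
      by (metis (lifting) card_Un_le)
    also have "\<dots> \<le> 2 * 2 ^ (card (K - S) div 2)"
      using half[of True] half[of False] IH by linarith
    also have "\<dots> = 2 ^ Suc (card (K - S) div 2)" by simp
    also have "\<dots> \<le> 2 ^ (card K div 2)"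
      using cS S(4) by (intro power_increasing) auto
    finally show ?thesis .
  qed
qed

text \<open>Such an A splits into an arbitrary part outside the support \<open>K\<close> and an
  invariant part inside it, where \<sigma> has no fixed points.\<close>

lemma card_invariant_subsets:
  assumes "finite P" "\<sigma> permutes P"
  defines "k \<equiv> card {x. \<sigma> x \<noteq> x}"
  shows "card {A \<in> Pow P. \<sigma> ` A = A} \<le> 2 ^ (card P - k + k div 2)"
proof -
  define K where "K = {x. \<sigma> x \<noteq> x}"
  have KP: "K \<subseteq> P" using assms(2) by (auto simp: K_def dest: permutes_not_in)
  then have fK: "finite K" using assms(1) finite_subset by blast
  have inj: "inj \<sigma>" using assms(2) by (rule permutes_inj)
  have "\<sigma> permutes K"
    by (rule permutes_superset[OF assms(2)]) (auto simp: K_def)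
  then have bij: "bij_betw \<sigma> K K" by (rule permutes_imp_bij)
  then have sK: "\<sigma> ` K = K" by (rule bij_betw_imp_surj_on)
  let ?Inv = "{A. A \<subseteq> K \<and> \<sigma> ` A = A}"
  have "finite ?Inv" using fK by (auto intro: finite_subset[of _ "Pow K"])
  then have "card {A \<in> Pow P. \<sigma> ` A = A} \<le> card (Pow (P - K) \<times> ?Inv)"
  proof (intro card_inj_on_le[of "\<lambda>A. (A - K, A \<inter> K)"])
    show "inj_on (\<lambda>A. (A - K, A \<inter> K)) {A \<in> Pow P. \<sigma> ` A = A}"
      by (rule inj_onI) blast
    show "(\<lambda>A. (A - K, A \<inter> K)) ` {A \<in> Pow P. \<sigma> ` A = A} \<subseteq> Pow (P - K) \<times> ?Inv"
      using image_Int[OF inj] sK by auto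
  qed (use assms(1) in auto)
  also have "\<dots> \<le> 2 ^ (card P - k) * 2 ^ (k div 2)"
    using card_invariant_subsets_fixpoint_free[OF fK bij] assms(1) KP fK
    by (simp add: card_cartesian_product card_Pow card_Diff_subset K_def k_def)
  finally show ?thesis by (simp add: power_add)
qed

section \<open>Burnside bound\<close>

text \<open>The inequality half of Burnside's lemma: \<open>R\<close> meets each orbit at most once,
  and pairs (M, g) are injected into pairs of a permutation and a multiset fixed by it.\<close>

lemma orbit_representatives_le_fixed:
  fixes P :: "'a set"
  assumes "finite P" "R \<subseteq> multisets_of_size (Pow P) b"
    and sep: "\<And>M M' \<sigma>. M \<in> R \<Longrightarrow> M' \<in> R \<Longrightarrow> \<sigma> permutes P \<Longrightarrow> image_mset ((`) \<sigma>) M = M' \<Longrightarrow> M = M'"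
  shows "card R * fact (card P)
    \<le> (\<Sum>\<sigma> | \<sigma> permutes P. card {M \<in> multisets_of_size (Pow P) b. image_mset ((`) \<sigma>) M = M})"
proof -
  let ?G = "{\<sigma>. \<sigma> permutes P}" and ?X = "multisets_of_size (Pow P) b"
  let ?act = "\<lambda>\<sigma>. image_mset ((`) \<sigma>) :: 'a set multiset \<Rightarrow> _"
  let ?Fix = "\<lambda>\<sigma>. {M \<in> ?X. ?act \<sigma> M = M}"
  have fG: "finite ?G" using assms(1) by (rule finite_permutations)
  have fX: "finite ?X" using assms(1) by (simp add: finite_multisets_of_size)
  have comp: "?act \<sigma> (?act \<tau> M) = ?act (\<sigma> \<circ> \<tau>) M" for \<sigma> \<tau> M
    by (simp add: multiset.map_comp comp_def image_image)
  have act_id: "?act id M = M" for M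
    by simp
  have act_X: "?act \<sigma> M \<in> ?X" if "\<sigma> permutes P" "M \<in> ?X" for \<sigma> M
    using that permutes_image[OF that(1)] by (fastforce simp: multisets_of_size_def)
  \<comment> \<open>A chosen permutation carrying the representative of the orbit to M'. It depends
    on M' alone, so equal images under \<open>\<Phi>\<close> have the same one, and it can be
    cancelled to recover g.\<close>
  define rep where "rep M' = (SOME c. c permutes P \<and> (\<exists>M\<in>R. ?act c M = M'))" for M'
  have rep: "rep (?act g M) permutes P \<and> ?act (rep (?act g M)) M = ?act g M"
    if "g permutes P" "M \<in> R" for g M
  proof -
    have "\<exists>c. c permutes P \<and> (\<exists>M0\<in>R. ?act c M0 = ?act g M)" using that by blast
    then have "rep (?act g M) permutes P \<and> (\<exists>M0\<in>R. ?act (rep (?act g M)) M0 = ?act g M)"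
      unfolding rep_def by (rule someI_ex)
    then obtain M0 where c: "rep (?act g M) permutes P" "M0 \<in> R" "?act (rep (?act g M)) M0 = ?act g M"
      by blast
    have "?act (inv g \<circ> rep (?act g M)) M0 = ?act (inv g \<circ> g) M"
      using c(3) by (simp only: flip: comp)
    then have "?act (inv g \<circ> rep (?act g M)) M0 = M"
      using permutes_inv_o(2)[OF that(1)] act_id by simp
    then have "M0 = M"
      using sep[OF c(2) that(2)] permutes_compose[OF c(1) permutes_inv[OF that(1)]] by blast
    then show ?thesis using c by blast
  qed
  define \<Phi> where "\<Phi> = (\<lambda>(M, g). (g \<circ> inv (rep (?act g M)), ?act g M))"
  have "card (R \<times> ?G) \<le> card (Sigma ?G ?Fix)"
  proof (rule card_inj_on_le)
    show "inj_on \<Phi> (R \<times> ?G)"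
    proof (rule inj_onI)
      fix p p' assume "p \<in> R \<times> ?G" "p' \<in> R \<times> ?G" and "\<Phi> p = \<Phi> p'"
      then obtain M g M' g' where p: "p = (M, g)" "p' = (M', g')"
        and M: "M \<in> R" and g: "g permutes P" and M': "M' \<in> R" and g': "g' permutes P"
        and eq: "\<Phi> (M, g) = \<Phi> (M', g')"
        by blast
      define c where "c = rep (?act g M)"
      have a: "?act g M = ?act g' M'" and o: "g \<circ> inv c = g' \<circ> inv c"
        using eq by (auto simp: \<Phi>_def c_def)
      have c: "c permutes P" using rep[OF g M] by (simp add: c_def)
      have "g = g \<circ> inv c \<circ> c" using permutes_inv_o(2)[OF c] by (simp add: comp_assoc)
      also have "\<dots> = g' \<circ> inv c \<circ> c" by (simp only: o)
      also have "\<dots> = g'" using permutes_inv_o(2)[OF c] by (simp add: comp_assoc)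
      finally have gg: "g = g'" .
      have "?act (inv g \<circ> g) M = ?act (inv g \<circ> g) M'"
        using a gg by (simp only: flip: comp)
      then have "M = M'" using permutes_inv_o(2)[OF g] act_id by simp
      with gg show "p = p'" by (simp add: p)
    qed
    show "\<Phi> ` (R \<times> ?G) \<subseteq> Sigma ?G ?Fix"
    proof
      fix q assume "q \<in> \<Phi> ` (R \<times> ?G)"
      then obtain M g where M: "M \<in> R" and g: "g permutes P" and "q = \<Phi> (M, g)" by blast
      moreover obtain \<tau> N where q: "q = (\<tau>, N)" by (cases q)
      ultimately have eq: "(\<tau>, N) = \<Phi> (M, g)" by simp
      define c where "c = rep (?act g M)"
      have c: "c permutes P" "?act c M = ?act g M" using rep[OF g M] by (simp_all add: c_def)
      have \<tau>: "\<tau> = g \<circ> inv c" and N: "N = ?act g M" using eq by (auto simp: \<Phi>_def c_def)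
      have "?act \<tau> N = ?act g (?act (inv c) (?act c M))"
        by (simp only: \<tau> N c(2) flip: comp)
      also have "\<dots> = N"
        by (simp only: comp N permutes_inv_o(2)[OF c(1)] comp_id)
      finally show "q \<in> Sigma ?G ?Fix"
        using q \<tau> N act_X[OF g] M assms(2) permutes_compose[OF permutes_inv[OF c(1)] g] by auto
    qed
    show "finite (Sigma ?G ?Fix)" using fG fX by auto
  qed
  then show ?thesis
    using fG fX assms(1) by (simp add: card_cartesian_product card_SigmaI card_permutations)
qed

lemma count_image_mset_inj:
  assumes "inj f"
  shows "count (image_mset f M) (f x) = count M x"
  by (induction M) (simp_all add: inj_eq[OF assms])

lemma card_fixed_msets_le:
  assumes "finite P" "\<sigma> permutes P"
  defines "k \<equiv> card {x. \<sigma> x \<noteq> x}"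
  shows "fact b * card {M \<in> multisets_of_size (Pow P) b. image_mset ((`) \<sigma>) M = M}
    \<le> fixed_poly (2 ^ (card P - k + k div 2)) (2 ^ card P) b"
proof -
  have inj: "inj ((`) \<sigma>)" 
    by (rule injI) (simp add: inj_image_eq_iff[OF permutes_inj[OF assms(2)]])
  have bij: "bij_betw ((`) \<sigma>) (Pow P) (Pow P)"
    using permutes_imp_bij[OF assms(2)] by (rule bij_betw_Pow)
  have "{M \<in> multisets_of_size (Pow P) b. image_mset ((`) \<sigma>) M = M} \<subseteq> invariant_msets ((`) \<sigma>) (Pow P) b"
  proof clarify
    fix M assume M: "M \<in> multisets_of_size (Pow P) b" and eq: "image_mset ((`) \<sigma>) M = M"
    have "count M (\<sigma> ` A) = count M A" for A
      using count_image_mset_inj[OF inj, of M A] by (simp only: eq)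
    then show "M \<in> invariant_msets ((`) \<sigma>) (Pow P) b"
      using M by (simp add: invariant_msets_def multisets_of_size_def)
  qed
  then have "fact b * card {M \<in> multisets_of_size (Pow P) b. image_mset ((`) \<sigma>) M = M}
      \<le> fact b * card (invariant_msets ((`) \<sigma>) (Pow P) b)"
    using assms(1) by (intro mult_left_mono card_mono finite_invariant_msets) auto
  also have "\<dots> \<le> fixed_poly (card {A \<in> Pow P. \<sigma> ` A = A}) (card (Pow P)) b"
    \<comment> \<open>The empty set is fixed by every \<sigma> and serves as the required fixed
      point.\<close>
    using assms(1) by (intro card_invariant_msets_le[OF _ bij, of "{}"]) auto
  also have "\<dots> \<le> fixed_poly (2 ^ (card P - k + k div 2)) (2 ^ card P) b"
    using card_invariant_subsets[OF assms(1,2)] assms(1)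
    unfolding k_def by (simp only: card_Pow fixed_poly_mono)
  finally show ?thesis .
qed

lemma sum_card_fixed_msets_le:
  assumes "finite P" "card P < b"
  shows "fact b * (\<Sum>\<sigma> | \<sigma> permutes P. card {M \<in> multisets_of_size (Pow P) b. image_mset ((`) \<sigma>) M = M})
    \<le> 2 * pochhammer (2 ^ card P) b"
proof -
  let ?a = "card P"
  let ?g = "\<lambda>k. fixed_poly (2 ^ (?a - k + k div 2)) (2 ^ ?a) b"
  have "fact b * (\<Sum>\<sigma> | \<sigma> permutes P. card {M \<in> multisets_of_size (Pow P) b. image_mset ((`) \<sigma>) M = M})
      \<le> (\<Sum>\<sigma> | \<sigma> permutes P. ?g (card {x. \<sigma> x \<noteq> x}))"
    unfolding sum_distrib_left using card_fixed_msets_le[OF assms(1)] by (intro sum_mono) simp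
  also have "\<dots> = (\<Sum>k\<le>?a. (?a choose k) * derangements k * ?g k)"
    by (rule sum_permutes_card_support[OF assms(1)])
  \<comment> \<open>k = 0 is the identity and gives the Pochhammer symbol; k = 1 contributes 0. The
    inequality covers a = 0, where the index 1 is new.\<close>
  also have "\<dots> \<le> (\<Sum>k\<in>insert 0 (insert 1 {2..?a}). (?a choose k) * derangements k * ?g k)"
    by (intro sum_mono2) auto
  also have "\<dots> = pochhammer (2 ^ ?a) b + nonid_sum ?a b"
    by (simp add: derangements_values fixed_poly_diag nonid_sum_def)
  also have "\<dots> \<le> 2 * pochhammer (2 ^ ?a) b"
    using nonid_sum_le[of ?a b] assms(2) by simp
  finally show ?thesis .
qed

lemma pochhammer_binomial:
  assumes "0 < (N::nat)"
  shows "pochhammer N b = fact b * ((b + N - 1) choose b)"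
proof -
  obtain m where N: "N = Suc m" using assms gr0_implies_Suc by blast
  have "fact m * pochhammer N b = fact (b + m)"
    using pochhammer_product'[of "1::nat" m b] by (simp add: N pochhammer_fact add.commute)
  also have "\<dots> = fact m * (fact b * ((b + N - 1) choose b))"
    using binomial_fact_lemma[of b "b + m"] by (simp add: N ac_simps)
  finally show ?thesis by simp
qed

text \<open>Common interface for columns and rows: if graphs whose encodings share an orbit are
  equivalent, then one representative per class yields multisets in distinct orbits.\<close>

lemma card_quotient_le:
  fixes P :: "'a set" and \<phi> :: "'g \<Rightarrow> 'a set multiset"
  assumes "equiv U r" "\<G> \<subseteq> U" "finite P" "card P < b"
    and \<phi>: "\<And>E. E \<in> \<G> \<Longrightarrow> \<phi> E \<in> multisets_of_size (Pow P) b"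
    and sep: "\<And>E E' \<sigma>. E \<in> \<G> \<Longrightarrow> E' \<in> \<G> \<Longrightarrow> \<sigma> permutes P
      \<Longrightarrow> image_mset ((`) \<sigma>) (\<phi> E) = \<phi> E' \<Longrightarrow> (E, E') \<in> r"
  shows "real (card (\<G> // r)) \<le> 2 * real ((b + 2 ^ card P - 1) choose b) / fact (card P)"
proof -
  define rep where "rep q = (SOME E. E \<in> \<G> \<and> q = r `` {E})" for q
  have rep: "rep q \<in> \<G>" "q = r `` {rep q}" if "q \<in> \<G> // r" for q
  proof -
    have "\<exists>E. E \<in> \<G> \<and> q = r `` {E}" using that by (auto elim: quotientE)
    then have "rep q \<in> \<G> \<and> q = r `` {rep q}" unfolding rep_def by (rule someI_ex)
    then show "rep q \<in> \<G>" "q = r `` {rep q}" by blast+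
  qed
  have eqI: "q = q'" if "q \<in> \<G> // r" "q' \<in> \<G> // r" "\<sigma> permutes P"
    "image_mset ((`) \<sigma>) (\<phi> (rep q)) = \<phi> (rep q')" for q q' \<sigma>
    using sep[OF rep(1)[OF that(1)] rep(1)[OF that(2)] that(3,4)] rep(2)[OF that(1)] rep(2)[OF that(2)]
      equiv_class_eq[OF assms(1)] by metis
  define R where "R = (\<phi> \<circ> rep) ` (\<G> // r)"
  have "inj_on (\<phi> \<circ> rep) (\<G> // r)"
    by (rule inj_onI) (use eqI[OF _ _ permutes_id] in simp)
  then have "card (\<G> // r) = card R" by (simp only: R_def card_image)
  moreover have "card R * fact (card P)
      \<le> (\<Sum>\<sigma> | \<sigma> permutes P. card {M \<in> multisets_of_size (Pow P) b. image_mset ((`) \<sigma>) M = M})"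
    using assms(3)
  proof (rule orbit_representatives_le_fixed)
    show "R \<subseteq> multisets_of_size (Pow P) b" using \<phi> rep(1) by (auto simp: R_def)
    show "M = M'" if h: "M \<in> R" "M' \<in> R" "\<sigma> permutes P" "image_mset ((`) \<sigma>) M = M'" for M M' \<sigma>
    proof -
      obtain q q' where "q \<in> \<G> // r" "M = \<phi> (rep q)" "q' \<in> \<G> // r" "M' = \<phi> (rep q')"
        using h(1,2) by (auto simp: R_def)
      then show ?thesis using eqI[of q q' \<sigma>] h(3,4) by simp
    qed
  qed
  then have "fact b * (card R * fact (card P)) \<le> 2 * pochhammer (2 ^ card P) b"
    using sum_card_fixed_msets_le[OF assms(3,4)] by (meson le_trans mult_le_mono2)
  then have "fact b * (card R * fact (card P)) \<le> fact b * (2 * ((b + 2 ^ card P - 1) choose b))"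
    by (simp add: pochhammer_binomial ac_simps)
  then have "card R * fact (card P) \<le> 2 * ((b + 2 ^ card P - 1) choose b)"
    by simp
  then have "real (card R * fact (card P)) \<le> real (2 * ((b + 2 ^ card P - 1) choose b))"
    by (simp only: of_nat_le_iff)
  ultimately show ?thesis by (simp add: field_simps)
qed

section \<open>Classes of bipartite graphs\<close>

text \<open>\<open>card\<close> is 0 on infinite sets, so finiteness of \<open>J\<close> turns
  nonzero degree into the existence of a neighbour.\<close>

lemma connected_domain_iff:
  assumes "finite J" "E \<in> bipartite_graphs I J"
  shows "x \<in> connected_domain I E \<longleftrightarrow> (\<exists>y. (x, y) \<in> E)"
proof -
  have "{y. (x, y) \<in> E} \<subseteq> J" using assms(2) by (auto simp: bipartite_graphs_def)
  then have "finite {y. (x, y) \<in> E}" using assms(1) finite_subset by blast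
  then show ?thesis
    using assms(2)
    by (auto simp: connected_domain_def left_degree_def bipartite_graphs_def card_eq_0_iff)
qed

definition graphs_with_domain :: "'v set \<Rightarrow> 'v set \<Rightarrow> 'v set \<Rightarrow> ('v \<times> 'v) set set" where
  "graphs_with_domain I J D = {E \<in> bipartite_graphs I J. connected_domain I E = D}"

lemma graphs_with_domain_subset:
  assumes "finite J" "E \<in> graphs_with_domain I J D"
  shows "E \<subseteq> D \<times> J"
  using assms connected_domain_iff[OF assms(1), of E I]
  by (auto simp: graphs_with_domain_def bipartite_graphs_def)

text \<open>A permutation of \<open>D\<close> is the identity elsewhere, hence a bijection of
  \<open>I\<close>, and both graphs have no edges outside \<open>D\<close>.\<close>

lemma left_set_labeled_relI:
  assumes "finite J" "D \<subseteq> I" "E \<in> graphs_with_domain I J D" "E' \<in> graphs_with_domain I J D"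
    and "\<alpha> permutes D" "\<beta> permutes J"
    and iff: "\<And>x y. x \<in> D \<Longrightarrow> y \<in> J \<Longrightarrow> (x, y) \<in> E \<longleftrightarrow> (\<alpha> x, \<beta> y) \<in> E'"
  shows "(E, E') \<in> left_set_labeled_rel I J"
proof -
  have sub: "E \<subseteq> D \<times> J" "E' \<subseteq> D \<times> J"
    using assms(1,3,4) graphs_with_domain_subset by blast+
  have "(x, y) \<in> E \<longleftrightarrow> (\<alpha> x, \<beta> y) \<in> E'" if "y \<in> J" for x y
  proof (cases "x \<in> D")
    case False
    then show ?thesis using sub permutes_not_in[OF assms(5) False] by auto
  qed (use iff that in blast)
  moreover have "bij_betw \<alpha> I I" using permutes_subset[OF assms(5,2)] by (rule permutes_imp_bij)
  moreover have "bij_betw \<beta> J J" using assms(6) by (rule permutes_imp_bij)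
  ultimately show ?thesis
    using assms(3,4)
    by (auto simp: left_set_labeled_rel_def left_set_labeled_equivalent_def graphs_with_domain_def)
qed

text \<open>The encoding is the multiset of neighbourhoods of right vertices. If \<sigma> matches
  two such multisets, the matching of columns is the permutation \<beta> of
  \<open>J\<close>.\<close>

lemma card_classes_columns:
  assumes "finite J" "finite I" "D \<subseteq> I" "card D < card J"
  shows "real (card (graphs_with_domain I J D // left_set_labeled_rel I J))
    \<le> 2 * real ((card J + 2 ^ card D - 1) choose card J) / fact (card D)"
proof (rule card_quotient_le[OF equiv_left_set_labeled_rel])
  let ?\<phi> = "\<lambda>E. image_mset (\<lambda>y. {x. (x, y) \<in> E}) (mset_set J)"
  show "graphs_with_domain I J D \<subseteq> bipartite_graphs I J" by (auto simp: graphs_with_domain_def)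
  show "finite D" using assms(2,3) finite_subset by blast
  show "?\<phi> E \<in> multisets_of_size (Pow D) (card J)" if "E \<in> graphs_with_domain I J D" for E
    using graphs_with_domain_subset[OF assms(1) that] assms(1) by (auto simp: multisets_of_size_def)
  fix E E' \<sigma>
  assume E: "E \<in> graphs_with_domain I J D" "E' \<in> graphs_with_domain I J D" and s: "\<sigma> permutes D"
    and "image_mset ((`) \<sigma>) (?\<phi> E) = ?\<phi> E'"
  then have "image_mset (\<lambda>y. \<sigma> ` {x. (x, y) \<in> E}) (mset_set J) = ?\<phi> E'"
    by (simp add: multiset.map_comp comp_def)
  then obtain \<beta> where b: "\<beta> permutes J" "\<forall>y\<in>J. \<sigma> ` {x. (x, y) \<in> E} = {x. (x, \<beta> y) \<in> E'}"
    by (rule image_mset_eq_implies_permutes[OF assms(1)])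
  show "(E, E') \<in> left_set_labeled_rel I J"
  proof (rule left_set_labeled_relI[OF assms(1,3) E s b(1)])
    fix x y assume "y \<in> J"
    have "(x, y) \<in> E \<longleftrightarrow> \<sigma> x \<in> \<sigma> ` {x. (x, y) \<in> E}"
      using inj_image_mem_iff[OF permutes_inj[OF s]] by auto
    then show "(x, y) \<in> E \<longleftrightarrow> (\<sigma> x, \<beta> y) \<in> E'" using b(2) \<open>y \<in> J\<close> by auto
  qed
qed (use assms in auto)

lemma rows_separate:
  assumes "finite J" "finite I" "D \<subseteq> I"
    and E: "E \<in> graphs_with_domain I J D" "E' \<in> graphs_with_domain I J D" and s: "\<sigma> permutes J"
    and eq: "image_mset ((`) \<sigma>) (image_mset (\<lambda>x. {y. (x, y) \<in> E}) (mset_set D))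
      = image_mset (\<lambda>x. {y. (x, y) \<in> E'}) (mset_set D)"
  shows "(E, E') \<in> left_set_labeled_rel I J"
proof -
  have fD: "finite D" using assms(2,3) finite_subset by blast
  have "image_mset (\<lambda>x. \<sigma> ` {y. (x, y) \<in> E}) (mset_set D)
      = image_mset (\<lambda>x. {y. (x, y) \<in> E'}) (mset_set D)"
    using eq by (simp add: multiset.map_comp comp_def)
  then obtain \<alpha> where a: "\<alpha> permutes D" "\<forall>x\<in>D. \<sigma> ` {y. (x, y) \<in> E} = {y. (\<alpha> x, y) \<in> E'}"
    by (rule image_mset_eq_implies_permutes[OF fD])
  show ?thesis
  proof (rule left_set_labeled_relI[OF assms(1,3) E a(1) s])
    fix x y assume "x \<in> D"
    have "(x, y) \<in> E \<longleftrightarrow> \<sigma> y \<in> \<sigma> ` {y. (x, y) \<in> E}"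
      using inj_image_mem_iff[OF permutes_inj[OF s]] by auto
    then show "(x, y) \<in> E \<longleftrightarrow> (\<alpha> x, \<sigma> y) \<in> E'" using a(2) \<open>x \<in> D\<close> by auto
  qed
qed

text \<open>Padding the rows with \<open>c\<close> empty sets does not merge classes; \<open>c = 1\<close> makes the
  orbit count applicable when \<open>D\<close> and \<open>J\<close> have the same size.\<close>

lemma card_classes_rows:
  assumes "finite J" "finite I" "D \<subseteq> I" "card J < card D + c"
  shows "real (card (graphs_with_domain I J D // left_set_labeled_rel I J))
    \<le> 2 * real ((card D + c + 2 ^ card J - 1) choose (card D + c)) / fact (card J)"
proof (rule card_quotient_le[OF equiv_left_set_labeled_rel])
  let ?\<phi> = "\<lambda>E. image_mset (\<lambda>x. {y. (x, y) \<in> E}) (mset_set D) + replicate_mset c {}"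
  show "graphs_with_domain I J D \<subseteq> bipartite_graphs I J" by (auto simp: graphs_with_domain_def)
  have fD: "finite D" using assms(2,3) finite_subset by blast
  show "?\<phi> E \<in> multisets_of_size (Pow J) (card D + c)" if "E \<in> graphs_with_domain I J D" for E
    using graphs_with_domain_subset[OF assms(1) that] fD
    by (auto simp: multisets_of_size_def split: if_splits)
  fix E E' \<sigma>
  assume E: "E \<in> graphs_with_domain I J D" "E' \<in> graphs_with_domain I J D" and s: "\<sigma> permutes J"
    and "image_mset ((`) \<sigma>) (?\<phi> E) = ?\<phi> E'"
  then show "(E, E') \<in> left_set_labeled_rel I J"
    by (intro rows_separate[OF assms(1-3) E s]) simp
qed (use assms in auto)

theorem theorem4:
  fixes I J :: "'v set" and n r :: nat
  assumes "finite I" and "finite J" and "I \<inter> J = {}"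
    and "card I = n" and "card J = r"
    and "n \<ge> 2" and "r \<ge> 2"
  shows "real (card (B\<^sub>x I J)) \<le>
      1 + 2 * (\<Sum>i=1..r-1. real (n choose i) * real ((r + 2^i - 1) choose r) / fact i)
        + 2 * real (n choose r) * real ((r + 2^r) choose (r + 1)) / fact r
        + 2 * (\<Sum>i=r+1..n. real (n choose i) * real ((i + 2^r - 1) choose i) / fact r)"
proof -
  let ?rel = "left_set_labeled_rel I J" and ?G = "graphs_with_domain I J"
  \<comment> \<open>\<open>g i\<close> bounds the number of classes with a given domain of size i:
    columns for i < r, rows for i > r, rows padded by one empty set for i = r, where r + 1 + 2^r - 1
    = r + 2^r.\<close>
  define g :: "nat \<Rightarrow> real" where
    "g i = (if i = 0 then 1
            else if i < r then 2 * (real ((r + 2^i - 1) choose r) / fact i)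
            else if i = r then 2 * (real ((r + 2^r) choose (r + 1)) / fact r)
            else 2 * (real ((i + 2^r - 1) choose i) / fact r))" for i
  have g_nonneg: "0 \<le> g i" for i by (simp add: g_def)
  have bound: "real (card (?G D // ?rel)) \<le> g (card D)" if D: "D \<in> Pow I" for D
  proof -
    have fD: "finite D" using D assms(1) finite_subset by auto
    consider "D = {}" | "D \<noteq> {}" "card D < r" | "card D = r" | "card D > r" by linarith
    then show ?thesis
    proof cases
      case 1
      have "E = {}" if "E \<in> ?G D" for E
        using graphs_with_domain_subset[OF assms(2) that] 1 by simp
      then have "?G D \<subseteq> {{}}" by blast
      then have "card (?G D // ?rel) \<le> card ({{}} // ?rel)"
        by (intro card_mono) (auto simp: quotient_def)
      also have "\<dots> = 1" by (simp add: quotient_def)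
      finally show ?thesis using 1 by (simp add: g_def)
    next
      case 2
      then show ?thesis
        using card_classes_columns[OF assms(2,1), of D] D assms(5) fD by (simp add: g_def)
    next
      case 3
      then show ?thesis
        using card_classes_rows[OF assms(2,1), of D 1] D assms(5,7) by (simp add: g_def)
    next
      case 4
      then show ?thesis
        using card_classes_rows[OF assms(2,1), of D 0] D assms(5) by (simp add: g_def)
    qed
  qed
  have "B\<^sub>x I J \<subseteq> (\<Union>D\<in>Pow I. ?G D // ?rel)"
  proof
    fix C assume "C \<in> B\<^sub>x I J"
    then obtain E where E: "E \<in> bipartite_graphs I J" "C = ?rel `` {E}"
      unfolding B\<^sub>x_def by (rule quotientE)
    then have "C \<in> ?G (connected_domain I E) // ?rel"
      by (simp add: quotientI graphs_with_domain_def)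
    moreover have "connected_domain I E \<in> Pow I" by (auto simp: connected_domain_def)
    ultimately show "C \<in> (\<Union>D\<in>Pow I. ?G D // ?rel)" by blast
  qed
  moreover have "finite (?G D // ?rel)" for D
  proof -
    have "?G D \<subseteq> Pow (I \<times> J)" by (auto simp: graphs_with_domain_def bipartite_graphs_def)
    then have "finite (?G D)" using assms(1,2) by (auto intro: finite_subset)
    then show ?thesis by (simp add: quotient_def)
  qed
  ultimately have "card (B\<^sub>x I J) \<le> card (\<Union>D\<in>Pow I. ?G D // ?rel)"
    using assms(1) by (intro card_mono) auto
  also have "\<dots> \<le> (\<Sum>D\<in>Pow I. card (?G D // ?rel))"
    using assms(1) by (intro card_UN_le) simp
  finally have "real (card (B\<^sub>x I J)) \<le> real (\<Sum>D\<in>Pow I. card (?G D // ?rel))"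
    by (simp only: of_nat_le_iff)
  also have "\<dots> \<le> (\<Sum>D\<in>Pow I. g (card D))"
    unfolding of_nat_sum by (rule sum_mono) (rule bound)
  also have "\<dots> = (\<Sum>i\<le>n. real (n choose i) * g i)"
    using sum_Pow_card[OF assms(1), of g] assms(4) by simp
  \<comment> \<open>For n < r the index set on the right exceeds {0..n}; the additional terms are
    nonnegative.\<close>
  also have "\<dots> \<le> (\<Sum>i\<in>{0} \<union> {1..r-1} \<union> {r} \<union> {r+1..n}. real (n choose i) * g i)"
    by (rule sum_mono2) (auto simp: g_nonneg)
  also have "\<dots> = real (n choose 0) * g 0 + (\<Sum>i=1..r-1. real (n choose i) * g i)
      + real (n choose r) * g r + (\<Sum>i=r+1..n. real (n choose i) * g i)"
    using assms(7) by (subst sum.union_disjoint; auto)+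
  also have "(\<Sum>i=1..r-1. real (n choose i) * g i)
      = 2 * (\<Sum>i=1..r-1. real (n choose i) * real ((r + 2^i - 1) choose r) / fact i)"
    unfolding sum_distrib_left by (intro sum.cong refl) (auto simp: g_def)
  also have "(\<Sum>i=r+1..n. real (n choose i) * g i)
      = 2 * (\<Sum>i=r+1..n. real (n choose i) * real ((i + 2^r - 1) choose i) / fact r)"
    unfolding sum_distrib_left by (intro sum.cong refl) (auto simp: g_def)
  also have "real (n choose 0) * g 0 = 1" by (simp add: g_def)
  also have "real (n choose r) * g r = 2 * real (n choose r) * real ((r + 2^r) choose (r + 1)) / fact r"
    using assms(7) by (simp add: g_def)
  finally show ?thesis .
qed

end
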